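(* Let $f(t),g(t)\in\mathbb{C}[[t]]$ be a delta series and an invertible series respectively, and let $r\ge 1$ be an integer. For every $n\ge0$, the Legendre-Gould Hopper based Sheffer polynomials ${}_{{}_{r}LeG^{(r)}}s_{n}(x,y,z)$ satisfy $${}_{{}_{r}LeG^{(r)}}s_{n}(x,y,z)=\int_{0}^{\infty} e^{-s}\;{}_{{}_{r}LeG^{(r)}}s_{n}(x,y,sD_{z}^{-1})\,ds.$$
   Context: A delta series is $f\in\mathbb{C}[[t]]$ with $f(0)=0$, $f'(0)\neq 0$; $f^{-1}$ denotes its compositional inverse. An invertible series is $g\in\mathbb{C}[[t]]$ with $g(0)\ne 0$. $C_0(x)=\sum_{k\ge 0}\frac{(-1)^k x^k}{(k!)^2}$. $D_z^{-1}$ is the inverse derivative operator in $z$, $D_z^{-1}h=\int_0^z h\,d\zeta$, so $D_z^{-k}\{1\}=z^k/k!$. For a polynomial $p(x,y,z)=\sum_k p_k(x,y)z^k$, the expression $p(x,y,sD_z^{-1})$ means the operator obtained by substituting $sD_z^{-1}$ for $z$, applied to the constant $1$: $p(x,y,sD_z^{-1})=\sum_k p_k(x,y)s^kD_z^{-k}\{1\}=\sum_k p_k(x,y)\frac{s^kz^k}{k!}$. The polynomials are determined by the generating function $$\frac{1}{g(f^{-1}(t))}\,C_0\!\left(x f^{-1}(t)\right)C_0\!\left(-y f^{-1}(t)\right)\exp\!\left(z\,(f^{-1}(t))^r\right)=\sum_{n=0}^{\infty}{}_{{}_{r}LeG^{(r)}}s_{n}(x,y,z)\frac{t^n}{(n!)^2}.$$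 *)

theory Defs
  imports
    "HOL-Complex_Analysis.Complex_Analysis"
    "HOL-Computational_Algebra.Computational_Algebra"
begin

definition delta_series :: "complex fps \<Rightarrow> bool"
  where "delta_series f \<longleftrightarrow> fps_nth f 0 = 0 \<and> fps_nth f 1 \<noteq> 0"

definition invertible_series :: "complex fps \<Rightarrow> bool"
  where "invertible_series g \<longleftrightarrow> fps_nth g 0 \<noteq> 0"

definition C0 :: "complex fps"
  where "C0 = Abs_fps (\<lambda>k. (- 1) ^ k / (fact k)\<^sup>2)"

text \<open>
  The polynomial ring \<open>\<complex>[x, y, z]\<close> is represented as \<open>\<complex>[x][y][z]\<close>: the innermost variable
  is \<open>x\<close>, the outermost one is \<open>z\<close>, so that \<open>coeff p k\<close> is the polynomial \<open>p\<^sub>k(x, y)\<close> in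
  \<open>p(x, y, z) = \<Sum>\<^sub>k p\<^sub>k(x, y) z\<^sup>k\<close>.
\<close>

type_synonym poly3 = "complex poly poly poly"

definition const3 :: "complex \<Rightarrow> poly3"
  where "const3 c = [:[:[:c:]:]:]"

definition X3 :: poly3 where "X3 = [:[:[:0, 1:]:]:]"
definition Y3 :: poly3 where "Y3 = [:[:0, 1:]:]"
definition Z3 :: poly3 where "Z3 = [:0, 1:]"

definition eval_xy :: "poly3 \<Rightarrow> complex \<Rightarrow> complex \<Rightarrow> complex poly"
  where "eval_xy p x y = map_poly (\<lambda>q. poly (poly q [:y:]) x) p"

definition eval3 :: "poly3 \<Rightarrow> complex \<Rightarrow> complex \<Rightarrow> complex \<Rightarrow> complex"
  where "eval3 p x y z = poly (eval_xy p x y) z"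

definition lift3 :: "complex fps \<Rightarrow> poly3 fps"
  where "lift3 F = Abs_fps (\<lambda>n. const3 (fps_nth F n))"

text \<open>
  The generating function, as a formal power series in \<open>t\<close> over \<open>\<complex>[x, y, z]\<close>.
  Here \<open>fps_inv f\<close> is the compositional inverse and \<open>inverse\<close> the multiplicative one.
\<close>

definition LeGH_gen :: "complex fps \<Rightarrow> complex fps \<Rightarrow> nat \<Rightarrow> poly3 fps"
  where "LeGH_gen f g r =
    lift3 (inverse (g oo fps_inv f))
    * (lift3 C0 oo (fps_const X3 * lift3 (fps_inv f)))
    * (lift3 C0 oo (fps_const (- Y3) * lift3 (fps_inv f)))
    * (lift3 (fps_exp 1) oo (fps_const Z3 * lift3 (fps_inv f) ^ r))"

definition LeGH_sheffer :: "complex fps \<Rightarrow> complex fps \<Rightarrow> nat \<Rightarrow> nat \<Rightarrow> poly3"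
  where "LeGH_sheffer f g r n = const3 ((fact n)\<^sup>2) * fps_nth (LeGH_gen f g r) n"

definition D_inv :: "(complex \<Rightarrow> complex) \<Rightarrow> complex \<Rightarrow> complex"
  where "D_inv h z = contour_integral (linepath 0 z) h"

text \<open>The operator \<open>p(T)\<close> for a polynomial \<open>p\<close> in one variable, applied to \<open>h\<close>.\<close>

definition poly_op ::
  "complex poly \<Rightarrow> ((complex \<Rightarrow> complex) \<Rightarrow> complex \<Rightarrow> complex) \<Rightarrow> (complex \<Rightarrow> complex) \<Rightarrow> complex \<Rightarrow> complex"
  where "poly_op p T h z = (\<Sum>k\<le>degree p. coeff p k * (T ^^ k) h z)"

text \<open>\<open>p(x, y, s D\<^sub>z\<^sup>-\<^sup>1){1}\<close>, evaluated at \<open>z\<close>.\<close>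

definition subst_D_inv :: "poly3 \<Rightarrow> complex \<Rightarrow> complex \<Rightarrow> complex \<Rightarrow> complex \<Rightarrow> complex"
  where "subst_D_inv p x y s z = poly_op (eval_xy p x y) (\<lambda>h \<zeta>. s * D_inv h \<zeta>) (\<lambda>_. 1) z"


text \<open>
  Evaluating the coefficients of \<^term>\<open>LeGH_gen f g r\<close> at complex \<open>x, y, z\<close> gives the
  generating function with complex parameters.
\<close>

lemma eval3_alt: "eval3 p x y z = poly (poly (poly p [:[:z:]:]) [:y:]) x"
proof -
  have "eval3 p x y z = (\<Sum>k\<le>degree p. poly (poly (coeff p k) [:y:]) x * z ^ k)"
    unfolding eval3_def eval_xy_def
    by (subst poly_altdef, rule sum.mono_neutral_cong_left)
       (auto simp: coeff_map_poly map_poly_degree_leq coeff_eq_0 intro: le_degree)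
  also have "\<dots> = poly (poly (poly p [:[:z:]:]) [:y:]) x"
    by (simp add: poly_altdef[of p] poly_sum poly_power)
  finally show ?thesis .
qed

lemma eval3_simps:
  "eval3 (p + q) x y z = eval3 p x y z + eval3 q x y z"
  "eval3 (p * q) x y z = eval3 p x y z * eval3 q x y z"
  "eval3 (- p) x y z = - eval3 p x y z"
  "eval3 (sum h A) x y z = (\<Sum>a\<in>A. eval3 (h a) x y z)"
  "eval3 0 x y z = 0" "eval3 1 x y z = 1"
  "eval3 (const3 c) x y z = c"
  "eval3 X3 x y z = x" "eval3 Y3 x y z = y" "eval3 Z3 x y z = z"
  by (simp_all add: eval3_alt poly_sum const3_def X3_def Y3_def Z3_def)

definition eval_fps3 :: "poly3 fps \<Rightarrow> complex \<Rightarrow> complex \<Rightarrow> complex \<Rightarrow> complex fps"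
  where "eval_fps3 F x y z = Abs_fps (\<lambda>n. eval3 (fps_nth F n) x y z)"

lemma eval_fps3_mult:
  "eval_fps3 (F * G) x y z = eval_fps3 F x y z * eval_fps3 G x y z"
  by (rule fps_ext) (simp add: eval_fps3_def fps_mult_nth eval3_simps)

lemma eval_fps3_power: "eval_fps3 (F ^ n) x y z = eval_fps3 F x y z ^ n"
proof (induction n)
  case 0
  show ?case by (rule fps_ext) (simp add: eval_fps3_def eval3_simps)
next
  case (Suc n)
  then show ?case by (simp add: eval_fps3_mult)
qed

lemma eval_fps3_compose:
  "eval_fps3 (F oo G) x y z = eval_fps3 F x y z oo eval_fps3 G x y z"
proof (rule fps_ext)
  fix n
  show "fps_nth (eval_fps3 (F oo G) x y z) n = fps_nth (eval_fps3 F x y z oo eval_fps3 G x y z) n"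
    unfolding fps_compose_nth eval_fps3_power[symmetric]
    by (simp add: eval_fps3_def fps_compose_nth eval3_simps)
qed

lemma eval_fps3_lift3: "eval_fps3 (lift3 F) x y z = F"
  by (rule fps_ext) (simp add: eval_fps3_def lift3_def eval3_simps)

lemma eval_fps3_const: "eval_fps3 (fps_const p) x y z = fps_const (eval3 p x y z)"
  by (rule fps_ext) (simp add: eval_fps3_def eval3_simps)

theorem LeGH_sheffer_generating_function:
  "inverse (g oo fps_inv f)
     * (C0 oo (fps_const x * fps_inv f))
     * (C0 oo (fps_const (- y) * fps_inv f))
     * (fps_exp 1 oo (fps_const z * fps_inv f ^ r))
   = Abs_fps (\<lambda>n. eval3 (LeGH_sheffer f g r n) x y z / (fact n)\<^sup>2)"
proof -
  have "Abs_fps (\<lambda>n. eval3 (LeGH_sheffer f g r n) x y z / (fact n)\<^sup>2) = eval_fps3 (LeGH_gen f g r) x y z"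
    by (rule fps_ext) (simp add: eval_fps3_def LeGH_sheffer_def eval3_simps)
  then show ?thesis
    by (simp only: LeGH_gen_def eval_fps3_mult eval_fps3_compose eval_fps3_power eval_fps3_lift3
        eval_fps3_const eval3_simps)
qed

end

theory Submission
  imports Defs "HOL-Probability.Distributions"
begin

text \<open>With x and y fixed, the substitution of s times the inverse derivative acts on a
  polynomial in z as a Borel transform: by \<open>scaled_D_inv_funpow\<close> it turns z^k into s^k
  z^k / k!. The integral against e^(-s) undoes it, since the k-th moment of that weight is k!
  (\<open>has_bochner_integral_power_times_exp\<close>). A polynomial has finitely many terms, so
  linearity gives integrability and value together.\<close>

lemma D_inv_monomial:
  "D_inv (\<lambda>\<zeta>. c * \<zeta> ^ k) z = c * z ^ Suc k / of_nat (Suc k)"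
proof -
  have "((\<lambda>\<zeta>. c * \<zeta> ^ Suc k / of_nat (Suc k)) has_field_derivative c * \<zeta> ^ k) (at \<zeta> within UNIV)"
    for \<zeta> :: complex
    by (auto intro!: derivative_eq_intros simp del: of_nat_Suc power_Suc)
  \<comment> \<open>The exponent \<open>Suc k\<close> is positive, so the primitive vanishes at the
    start point 0 and only the end point contributes.\<close>
  then have "((\<lambda>\<zeta>. c * \<zeta> ^ k) has_contour_integral
      c * pathfinish (linepath 0 z) ^ Suc k / of_nat (Suc k)
      - c * pathstart (linepath 0 z) ^ Suc k / of_nat (Suc k)) (linepath 0 z)"
    by (rule contour_integral_primitive) (rule valid_path_linepath, simp)
  then show ?thesis
    by (simp add: D_inv_def contour_integral_unique)
qed

text \<open>Each application divides by the new exponent, and these divisors accumulate to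
  \<open>fact k\<close>. The equation is between functions because the next application integrates
  along a whole segment.\<close>

lemma scaled_D_inv_funpow:
  "((\<lambda>h \<zeta>. s * D_inv h \<zeta>) ^^ k) (\<lambda>_. 1) = (\<lambda>z. s ^ k / fact k * z ^ k)"
proof (induction k)
  case (Suc k)
  then have "((\<lambda>h \<zeta>. s * D_inv h \<zeta>) ^^ Suc k) (\<lambda>_. 1) = (\<lambda>z. s * D_inv (\<lambda>\<zeta>. s ^ k / fact k * \<zeta> ^ k) z)"
    by simp
  also have "\<dots> = (\<lambda>z. s ^ Suc k / fact (Suc k) * z ^ Suc k)"
    by (simp only: D_inv_monomial) (simp add: fact_Suc mult_ac del: of_nat_Suc)
  finally show ?case .
qed simp

lemma poly_op_scaled_D_inv:
  "poly_op p (\<lambda>h \<zeta>. s * D_inv h \<zeta>) (\<lambda>_. 1) z = (\<Sum>k\<le>degree p. coeff p k * z ^ k / fact k * s ^ k)"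
  by (simp add: poly_op_def scaled_D_inv_funpow mult_ac)

text \<open>This is Euler's integral for \<Gamma>(k+1), in the indicator form to which set integrals
  unfold.\<close>

lemma has_bochner_integral_power_times_exp:
  "has_bochner_integral lborel (\<lambda>s::real. indicator {0..} s *\<^sub>R complex_of_real (s ^ k * exp (- s))) (fact k)"
proof -
  have "has_bochner_integral lborel (\<lambda>s::real. s ^ k * exp (- s) * indicator {0..} s) (fact k)"
  \<comment> \<open>The integrand is nonnegative, so a finite nonnegative integral yields both
    integrability and the value.\<close>
  proof (rule has_bochner_integral_nn_integral)
    have "(\<integral>\<^sup>+ s. ennreal (s ^ k * exp (- s) * indicator {0..} s) \<partial>lborel)
        = (\<integral>\<^sup>+ s. ennreal (s ^ k * exp (- s)) * indicator {0..} s \<partial>lborel)"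
      by (intro nn_integral_cong) (simp add: indicator_def)
    then show "(\<integral>\<^sup>+ s. ennreal (s ^ k * exp (- s) * indicator {0..} s) \<partial>lborel) = ennreal (fact k)"
      by (simp add: nn_intergal_power_times_exp_Ici)
  qed (auto simp: indicator_def)
  then have "has_bochner_integral lborel
      (\<lambda>s::real. complex_of_real (s ^ k * exp (- s) * indicator {0..} s)) (complex_of_real (fact k))"
    by (rule has_bochner_integral_of_real)
  then show ?thesis
    by (simp add: scaleR_conv_of_real mult_ac)
qed

text \<open>In each term the 1/k! from iterated integration cancels against the moment k!, leaving
  \<open>coeff p k * z ^ k\<close>.\<close>

lemma has_bochner_integral_poly_op_scaled_D_inv:
  "has_bochner_integral lborel
     (\<lambda>s::real. indicator {0..} s *\<^sub>R (complex_of_real (exp (- s)) *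
        poly_op p (\<lambda>h \<zeta>. complex_of_real s * D_inv h \<zeta>) (\<lambda>_. 1) z)) (poly p z)"
proof -
  have "has_bochner_integral lborel
      (\<lambda>s. \<Sum>k\<le>degree p. (coeff p k * z ^ k / fact k) *
        (indicator {0..} s *\<^sub>R complex_of_real (s ^ k * exp (- s))))
      (\<Sum>k\<le>degree p. (coeff p k * z ^ k / fact k) * fact k)"
    by (intro has_bochner_integral_sum has_bochner_integral_mult_right
        has_bochner_integral_power_times_exp)
  then show ?thesis
    by (simp add: poly_op_scaled_D_inv poly_altdef sum_distrib_left scaleR_sum_right
        scaleR_conv_of_real mult_ac)
qed

theorem theorem4p5:
  fixes f g :: "complex fps" and r n :: nat and x y z :: complex
  assumes "delta_series f" and "invertible_series g" and "r \<ge> 1"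
  shows "set_integrable lborel {0..}
           (\<lambda>s::real. complex_of_real (exp (- s)) *
              subst_D_inv (LeGH_sheffer f g r n) x y (complex_of_real s) z)
         \<and> eval3 (LeGH_sheffer f g r n) x y z =
             (LINT s:{0..}|lborel. complex_of_real (exp (- s)) *
              subst_D_inv (LeGH_sheffer f g r n) x y (complex_of_real s) z)"
  \<comment> \<open>The two conjuncts are the two halves of the Bochner statement.\<close>
  using has_bochner_integral_poly_op_scaled_D_inv[of "eval_xy (LeGH_sheffer f g r n) x y" z]
  by (simp add: set_integrable_def set_lebesgue_integral_def subst_D_inv_def eval3_def
      has_bochner_integral_iff)

end
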